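(* Let $k \ge 2$ be an integer. For $i = 1, 2, \dots, n$, let $r_i$ be a positive integer, let $v_i = (k-1) r_i + k + 1$, and suppose there exists a pentagonal geometry $\mathrm{PENT}(k, r_i)$ with exactly $p_i$ opposite line pairs. Suppose also that, for some positive integers $u_1, \dots, u_n$, there exists a $k$-GDD of type $v_1^{u_1} v_2^{u_2} \cdots v_n^{u_n}$. Let $N = u_1 + u_2 + \dots + u_n$, $R = u_1 r_1 + u_2 r_2 + \dots + u_n r_n$ and $P = u_1 p_1 + u_2 p_2 + \dots + u_n p_n$. Then there exists a pentagonal geometry $\mathrm{PENT}(k, R + (N - 1)(k + 1)/(k - 1))$ with exactly $P$ opposite line pairs.
   Context: A partial linear space is a non-empty finite set of points together with a collection of subsets, called lines (or blocks), such that every line contains at least two points and any two distinct points lie together on at most one line. Two distinct points are collinear if some line contains both. For integers $k \ge 2$, $r \ge 1$, a pentagonal geometry $\mathrm{PENT}(k,r)$ is a partial linear space in which every line contains exactly $k$ points, every point lies on exactly $r$ lines, and for each point $x$ there is a line, denoted $x^{\mathrm{opp}}$, consisting of precisely those points $y \ne x$ that are not collinear with $x$. (It has $r(k-1)+k+1$ points.) An opposite line pair is an unordered pair of disjoint lines such that for each point $x$ on one of the two lines, $x^{\mathrm{opp}}$ is the other line. A group divisible design, $k$-GDD, of type $g_1^{u_1} g_2^{u_2} \cdots g_n^{u_n}$ is a triple $(V,\mathcal{G},\mathcal{B})$ such that: $V$ is a set of cardinality $u_1 g_1 + \dots + u_n g_n$; $\mathcal{G}$ is a partition of $V$ into $u_i$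 subsets of cardinality $g_i$, $i=1,\dots,n$, called groups; $\mathcal{B}$ is a non-empty collection of $k$-subsets of $V$, called blocks; and each pair of elements from distinct groups occurs in precisely one block but no pair of distinct elements from the same group occurs in any block. *)

theory Defs
  imports Complex_Main "HOL-Library.Multiset" "HOL-Library.Disjoint_Sets"
begin

locale partial_linear_space =
  fixes points :: "'a set" and lines :: "'a set set"
  assumes finite_points: "finite points"
    and points_nonempty: "points \<noteq> {}"
    and lines_subset: "L \<in> lines \<Longrightarrow> L \<subseteq> points"
    and line_card_ge_2: "L \<in> lines \<Longrightarrow> 2 \<le> card L"
    and line_unique: "\<lbrakk>x \<noteq> y; L \<in> lines; M \<in> lines; x \<in> L; y \<in> L; x \<in> M; y \<in> M\<rbrakk> \<Longrightarrow> L = M"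

definition collinear :: "'a set set \<Rightarrow> 'a \<Rightarrow> 'a \<Rightarrow> bool" where
  "collinear lines x y \<longleftrightarrow> x \<noteq> y \<and> (\<exists>L\<in>lines. x \<in> L \<and> y \<in> L)"

definition opp :: "'a set \<Rightarrow> 'a set set \<Rightarrow> 'a \<Rightarrow> 'a set" where
  "opp points lines x = {y \<in> points. y \<noteq> x \<and> \<not> collinear lines x y}"

locale pentagonal_geometry = partial_linear_space points lines
  for points :: "'a set" and lines :: "'a set set" +
  fixes k r :: nat
  assumes k_ge_2: "2 \<le> k"
    and r_ge_1: "1 \<le> r"
    and line_card: "L \<in> lines \<Longrightarrow> card L = k"
    and point_degree: "x \<in> points \<Longrightarrow> card {L \<in> lines. x \<in> L} = r"
    and opp_line: "x \<in> points \<Longrightarrow> opp points lines x \<in> lines"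

definition opposite_line_pairs :: "'a set \<Rightarrow> 'a set set \<Rightarrow> 'a set set set" where
  "opposite_line_pairs points lines =
     {{L, M} | L M. L \<in> lines \<and> M \<in> lines \<and> L \<inter> M = {} \<and>
        (\<forall>x\<in>L. opp points lines x = M) \<and> (\<forall>x\<in>M. opp points lines x = L)}"

text \<open>Geometries and designs are finite, so every one of them has an isomorphic copy whose points
  are natural numbers; existence is therefore stated over \<^typ>\<open>nat\<close>.\<close>

definition exists_PENT :: "nat \<Rightarrow> nat \<Rightarrow> nat \<Rightarrow> bool" where
  "exists_PENT k r p \<longleftrightarrow>
     (\<exists>(points :: nat set) lines.
        pentagonal_geometry points lines k r \<and> card (opposite_line_pairs points lines) = p)"

text \<open>The type \<open>g\<^sub>1\<^bsup>u\<^sub>1\<^esup> \<dots> g\<^sub>n\<^bsup>u\<^sub>n\<^esup>\<close> of a group divisible design is encoded as the multiset \<open>T\<close> of its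
  group sizes. If some of the \<open>g\<^sub>i\<close> coincide, their multiplicities \<open>u\<^sub>i\<close> add up.\<close>

locale group_divisible_design =
  fixes k :: nat and V :: "'a set" and groups :: "'a set set" and blocks :: "'a set set"
    and T :: "nat multiset"
  assumes finite_V: "finite V"
    and card_V: "card V = sum_mset T"
    and groups_partition: "partition_on V groups"
    and group_sizes: "image_mset card (mset_set groups) = T"
    and blocks_nonempty: "blocks \<noteq> {}"
    and block_subset: "B \<in> blocks \<Longrightarrow> B \<subseteq> V"
    and block_card: "B \<in> blocks \<Longrightarrow> card B = k"
    and distinct_groups: "\<lbrakk>G \<in> groups; H \<in> groups; G \<noteq> H; x \<in> G; y \<in> H\<rbrakk>
          \<Longrightarrow> \<exists>!B. B \<in> blocks \<and> x \<in> B \<and> y \<in> B"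
    and same_group: "\<lbrakk>G \<in> groups; x \<in> G; y \<in> G; x \<noteq> y; B \<in> blocks\<rbrakk> \<Longrightarrow> \<not> (x \<in> B \<and> y \<in> B)"

definition exists_GDD :: "nat \<Rightarrow> nat multiset \<Rightarrow> bool" where
  "exists_GDD k T \<longleftrightarrow> (\<exists>(V :: nat set) groups blocks. group_divisible_design k V groups blocks T)"

end

theory Submission
  imports Defs
begin

text \<open>Place on every group of the design a copy of a pentagonal geometry of the right size and take
  the blocks of the design as additional lines. Blocks join exactly the pairs of points in distinct
  groups, so the opposite line of a point is its opposite line inside its own group; in particular
  the opposite line pairs are those of the individual groups. The number of blocks through a point
  of the group \<open>G\<close> is \<open>(|V| - |G|) / (k - 1)\<close>, and since \<open>|G| = r (k - 1) + k + 1\<close>, adding the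
  degree \<open>r\<close> of the point inside \<open>G\<close> gives a number that is independent of \<open>G\<close>.\<close>

section \<open>Counting along a pencil of lines; lifting multiset images\<close>

text \<open>Deleting the common point \<open>x\<close> leaves pairwise disjoint sets of
  \<open>k - 1\<close> points. This serves both for the lines through a point of a geometry and for
  the blocks through a point of a design.\<close>

lemma card_pencil:
  assumes "finite F"
    and "\<And>L. L \<in> F \<Longrightarrow> x \<in> L \<and> finite L \<and> card L = k"
    and "\<And>L M. L \<in> F \<Longrightarrow> M \<in> F \<Longrightarrow> L \<noteq> M \<Longrightarrow> L \<inter> M \<subseteq> {x}"
  shows "card (\<Union>L\<in>F. L - {x}) = card F * (k - 1)"
proof -
  have "card (\<Union>L\<in>F. L - {x}) = (\<Sum>L\<in>F. card (L - {x}))"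
    using assms by (intro card_UN_disjoint) blast+
  also have "\<dots> = (\<Sum>L\<in>F. k - 1)"
    by (intro sum.cong refl) (use assms(2) in \<open>auto simp: card_Diff_singleton\<close>)
  finally show ?thesis by simp
qed

text \<open>Induction on \<open>A\<close>: the value \<open>c a\<close> is attained by some
  \<open>m\<close> in \<open>M\<close>, and removing \<open>a\<close> and \<open>m\<close> leaves a
  smaller instance. The lift is needed because \<open>v\<close> may identify different elements of
  \<open>M\<close>, so that \<open>c a\<close> alone does not determine \<open>f a\<close>.\<close>

lemma image_mset_lift:
  assumes "finite A" and "image_mset c (mset_set A) = image_mset v M"
  shows "\<exists>f. image_mset f (mset_set A) = M \<and> (\<forall>a\<in>A. c a = v (f a))"
  using assms
proof (induction A arbitrary: M rule: finite_induct)
  case empty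
  then show ?case by simp
next
  case (insert a A)
  then have "c a \<in># image_mset v M"
    by (metis finite_insert finite_set_mset_mset_set imageI insertI1 set_image_mset)
  then obtain m where m: "m \<in># M" "c a = v m" by auto
  then obtain M' where M': "M = add_mset m M'" by (meson multi_member_split)
  from insert.prems insert.hyps m M' have "image_mset c (mset_set A) = image_mset v M'" by simp
  from insert.IH[OF this] obtain f
    where f: "image_mset f (mset_set A) = M'" "\<forall>a\<in>A. c a = v (f a)" by blast
  have "image_mset (f(a := m)) (mset_set A) = image_mset f (mset_set A)"
    using insert.hyps by (intro image_mset_cong) auto
  then show ?case
    using f m M' insert.hyps by (intro exI[of _ "f(a := m)"]) (auto simp del: fun_upd_apply, auto)
qed

section \<open>Finiteness of lines; rules for opposite line pairs\<close>

context partial_linear_space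
begin

lemma finite_lines: "finite lines"
  using finite_points lines_subset by (intro finite_subset[of lines "Pow points"]) auto

lemma finite_line: "L \<in> lines \<Longrightarrow> finite L"
  using finite_points lines_subset finite_subset by blast

lemma line_nonempty: "L \<in> lines \<Longrightarrow> L \<noteq> {}"
  using line_card_ge_2 by fastforce

end

lemma opposite_line_pairsI:
  assumes "L \<in> lines" "M \<in> lines" "L \<inter> M = {}"
    and "\<And>x. x \<in> L \<Longrightarrow> opp points lines x = M" "\<And>x. x \<in> M \<Longrightarrow> opp points lines x = L"
  shows "{L, M} \<in> opposite_line_pairs points lines"
  using assms unfolding opposite_line_pairs_def by blast

lemma opposite_line_pairsE:
  assumes "X \<in> opposite_line_pairs points lines"
  obtains L M where "X = {L, M}" "L \<in> lines" "M \<in> lines" "L \<inter> M = {}"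
    "\<forall>x\<in>L. opp points lines x = M" "\<forall>x\<in>M. opp points lines x = L"
  using assms unfolding opposite_line_pairs_def by auto

lemma opposite_line_pairs_subset: "opposite_line_pairs points lines \<subseteq> Pow lines"
  unfolding opposite_line_pairs_def by auto

section \<open>Number of points and transport along injections\<close>

context pentagonal_geometry
begin

text \<open>Seen from a point \<open>x\<close>, the other points split into those on the
  \<open>r\<close> lines through \<open>x\<close>, which number \<open>r * (k - 1)\<close>, and the
  \<open>k\<close> points of the opposite line.\<close>

lemma card_points: "card points = (k - 1) * r + k + 1"
proof -
  obtain x where x: "x \<in> points" using points_nonempty by blast
  let ?F = "{L \<in> lines. x \<in> L}"
  let ?U = "\<Union>L\<in>?F. L - {x}"
  let ?O = "opp points lines x"
  have U: "card ?U = r * (k - 1)"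
  proof -
    have "card ?U = card ?F * (k - 1)"
    proof (rule card_pencil)
      show "L \<inter> M \<subseteq> {x}" if "L \<in> ?F" "M \<in> ?F" "L \<noteq> M" for L M
        using that line_unique by blast
    qed (use finite_lines finite_line line_card in auto)
    then show ?thesis using point_degree[OF x] by simp
  qed
  have "?U \<inter> ?O = {}" by (auto simp: opp_def collinear_def)
  moreover have "points - {x} = ?U \<union> ?O"
    using lines_subset by (auto simp: opp_def collinear_def)
  moreover have "finite ?U" "finite ?O"
    using finite_lines finite_line opp_line[OF x] by auto
  ultimately have "card (points - {x}) = card ?U + card ?O"
    by (simp only: card_Un_disjoint)
  then show ?thesis
    using U line_card[OF opp_line[OF x]] card.remove[OF finite_points x] by simp
qed

text \<open>A map injective on the points preserves and reflects incidence, hence collinearity,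
  hence non-collinearity.\<close>

lemma opp_image:
  assumes f: "inj_on f points" and x: "x \<in> points"
  shows "opp (f ` points) ((`) f ` lines) (f x) = f ` opp points lines x"
proof -
  have mem: "f z \<in> f ` L \<longleftrightarrow> z \<in> L" if "z \<in> points" "L \<in> lines" for z L
    using inj_on_image_mem_iff[OF f] that lines_subset by blast
  have "collinear ((`) f ` lines) (f x) (f y) \<longleftrightarrow> collinear lines x y" if "y \<in> points" for y
    using that x mem inj_on_eq_iff[OF f] by (auto simp: collinear_def)
  then show ?thesis
    using x inj_on_eq_iff[OF f] by (auto simp: opp_def)
qed

lemma image_eq_iff:
  assumes "inj_on f points" "L \<in> lines" "M \<in> lines"
  shows "f ` L = f ` M \<longleftrightarrow> L = M"
  using assms inj_on_image_eq_iff lines_subset by metis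

lemma pentagonal_geometry_image:
  assumes f: "inj_on f points"
  shows "pentagonal_geometry (f ` points) ((`) f ` lines) k r"
proof
  have mem: "f z \<in> f ` L \<longleftrightarrow> z \<in> L" if "z \<in> points" "L \<in> lines" for z L
    using inj_on_image_mem_iff[OF f] that lines_subset by blast
  have card: "card (f ` L) = card L" if "L \<in> lines" for L
    using that f lines_subset by (meson card_image inj_on_subset)
  show "finite (f ` points)" "f ` points \<noteq> {}" "2 \<le> k" "1 \<le> r"
    using finite_points points_nonempty k_ge_2 r_ge_1 by auto
  show "L \<subseteq> f ` points" "2 \<le> card L" "card L = k" if "L \<in> (`) f ` lines" for L
    using that lines_subset card line_card_ge_2 line_card by auto
  show "L = M" if hyps: "x \<noteq> y" "L \<in> (`) f ` lines" "M \<in> (`) f ` lines"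
    "x \<in> L" "y \<in> L" "x \<in> M" "y \<in> M" for x y L M
  proof -
    from hyps obtain L' M' where *: "L' \<in> lines" "M' \<in> lines" "L = f ` L'" "M = f ` M'" by auto
    with hyps obtain a b where ab: "a \<in> L'" "b \<in> L'" "x = f a" "y = f b" by auto
    with * have "a \<in> points" "b \<in> points" using lines_subset by auto
    with hyps * ab mem have "a \<noteq> b" "a \<in> M'" "b \<in> M'" by auto
    with * ab line_unique show ?thesis by blast
  qed
  show "card {L \<in> (`) f ` lines. y \<in> L} = r" if "y \<in> f ` points" for y
  proof -
    from that obtain x where x: "x \<in> points" "y = f x" by auto
    have "{L \<in> (`) f ` lines. y \<in> L} = (`) f ` {L \<in> lines. x \<in> L}"
      using x mem by auto
    moreover have "inj_on ((`) f) {L \<in> lines. x \<in> L}"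
      using image_eq_iff[OF f] by (auto simp: inj_on_def)
    ultimately show ?thesis using point_degree[OF x(1)] by (simp add: card_image)
  qed
  show "opp (f ` points) ((`) f ` lines) y \<in> (`) f ` lines" if "y \<in> f ` points" for y
    using that opp_image[OF f] opp_line by auto
qed

lemma card_opposite_line_pairs_image:
  assumes f: "inj_on f points"
  shows "card (opposite_line_pairs (f ` points) ((`) f ` lines))
    = card (opposite_line_pairs points lines)"
proof -
  \<comment> \<open>Both \<open>opp points lines x\<close> and \<open>M\<close> are lines, so
    equality of their images under \<open>f\<close> reflects to equality of the lines
    themselves.\<close>
  have eq: "((\<forall>x\<in>f ` L. opp (f ` points) ((`) f ` lines) x = f ` M)
      \<longleftrightarrow> (\<forall>x\<in>L. opp points lines x = M))" if "L \<in> lines" "M \<in> lines" for L M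
  proof -
    have "opp (f ` points) ((`) f ` lines) (f x) = f ` M \<longleftrightarrow> opp points lines x = M"
      if "x \<in> L" for x
      using that \<open>L \<in> lines\<close> \<open>M \<in> lines\<close> lines_subset opp_image[OF f] opp_line
        image_eq_iff[OF f] by (metis subsetD)
    then show ?thesis by auto
  qed
  have disj: "f ` L \<inter> f ` M = {} \<longleftrightarrow> L \<inter> M = {}" if "L \<in> lines" "M \<in> lines" for L M
    using that inj_on_image_Int[OF f, of L M] lines_subset by (metis image_is_empty)
  \<comment> \<open>A pair is a set of sets of points, so the family of all pairs is mapped by the
    image operation iterated three times.\<close>
  have "opposite_line_pairs (f ` points) ((`) f ` lines)
      = (`) ((`) f) ` opposite_line_pairs points lines" (is "?A = ?B")
  proof (intro equalityI subsetI)
    fix X assume "X \<in> ?A"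
    then obtain L' M' where *: "X = {L', M'}" "L' \<in> (`) f ` lines" "M' \<in> (`) f ` lines"
      "L' \<inter> M' = {}" "\<forall>x\<in>L'. opp (f ` points) ((`) f ` lines) x = M'"
      "\<forall>x\<in>M'. opp (f ` points) ((`) f ` lines) x = L'"
      by (rule opposite_line_pairsE)
    then obtain L M where LM: "L \<in> lines" "M \<in> lines" "L' = f ` L" "M' = f ` M" by blast
    have "{L, M} \<in> opposite_line_pairs points lines"
      using * LM eq[of L M] eq[of M L] by (intro opposite_line_pairsI) auto
    moreover have "X = (`) ((`) f) {L, M}" using *(1) LM by simp
    ultimately show "X \<in> ?B" by blast
  next
    fix X assume "X \<in> ?B"
    then obtain Y where "Y \<in> opposite_line_pairs points lines" "X = (`) ((`) f) Y" by blast
    then obtain L M where *: "L \<in> lines" "M \<in> lines" "X = {f ` L, f ` M}" "L \<inter> M = {}"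
      "\<forall>x\<in>L. opp points lines x = M" "\<forall>x\<in>M. opp points lines x = L"
      by (elim opposite_line_pairsE) simp
    have "{f ` L, f ` M} \<in> ?A"
      using * eq[of L M] eq[of M L] disj[of L M] by (intro opposite_line_pairsI) auto
    then show "X \<in> ?A" using *(3) by simp
  qed
  moreover have "inj_on ((`) ((`) f)) (opposite_line_pairs points lines)"
  proof (rule inj_on_subset[OF _ opposite_line_pairs_subset])
    show "inj_on ((`) ((`) f)) (Pow lines)"
      using image_eq_iff[OF f] by (intro inj_on_image_Pow) (auto simp: inj_on_def)
  qed
  ultimately show ?thesis by (simp add: card_image)
qed

end

text \<open>Any bijection between point sets of equal size carries the geometry over, so a group of
  the design can itself serve as the point set.\<close>

lemma exists_PENT_on:
  fixes G :: "nat set"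
  assumes "exists_PENT k r p" and "finite G" and "card G = (k - 1) * r + k + 1"
  shows "\<exists>lines. pentagonal_geometry G lines k r \<and> card (opposite_line_pairs G lines) = p"
proof -
  from assms(1) obtain points lines where *: "pentagonal_geometry (points :: nat set) lines k r"
    "card (opposite_line_pairs points lines) = p" unfolding exists_PENT_def by blast
  interpret pentagonal_geometry points lines k r by fact
  obtain f where "bij_betw f points G"
    using finite_same_card_bij[OF finite_points assms(2)] card_points assms(3) by auto
  then have "inj_on f points" "f ` points = G" by (auto simp: bij_betw_def)
  then show ?thesis
    using pentagonal_geometry_image card_opposite_line_pairs_image *(2) by metis
qed

section \<open>Designs with a geometry on every group: groups, blocks and filling lines\<close>

text \<open>Both \<open>fill\<close> and \<open>r\<close> depend on the group and not on its size,
  so groups of equal size may carry geometries with different numbers of opposite line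
  pairs.\<close>

locale filled_gdd = group_divisible_design k V groups blocks T
  for k :: nat and V :: "'a set" and groups :: "'a set set" and blocks :: "'a set set"
    and T :: "nat multiset" +
  fixes fill :: "'a set \<Rightarrow> 'a set set" and r :: "'a set \<Rightarrow> nat"
  assumes k_ge_2: "2 \<le> k"
    and fill: "G \<in> groups \<Longrightarrow> pentagonal_geometry G (fill G) k (r G)"
begin

definition filled_lines :: "'a set set" where
  "filled_lines = blocks \<union> (\<Union>G\<in>groups. fill G)"

lemma finite_groups: "finite groups"
  using finite_elements[OF finite_V groups_partition] .

lemma Union_groups: "\<Union>groups = V"
  using groups_partition by (simp add: partition_on_def)

lemma group_unique: "G \<in> groups \<Longrightarrow> H \<in> groups \<Longrightarrow> x \<in> G \<Longrightarrow> x \<in> H \<Longrightarrow> G = H"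
  using groups_partition by (auto simp: partition_on_def disjoint_def)

lemma obtain_group:
  assumes "x \<in> V" obtains G where "G \<in> groups" "x \<in> G"
  using assms Union_groups by auto

lemma group_subset: "G \<in> groups \<Longrightarrow> G \<subseteq> V"
  using Union_groups by auto

lemma finite_group: "G \<in> groups \<Longrightarrow> finite G"
  using group_subset finite_V finite_subset by blast

lemma finite_blocks: "finite blocks"
  using finite_V block_subset by (intro finite_subset[of blocks "Pow V"]) auto

lemma finite_block: "B \<in> blocks \<Longrightarrow> finite B"
  using finite_V block_subset finite_subset by blast

lemma fill_subset: "G \<in> groups \<Longrightarrow> L \<in> fill G \<Longrightarrow> L \<subseteq> G"
  using fill partial_linear_space.lines_subset pentagonal_geometry.axioms(1) by metis

lemma fill_card: "G \<in> groups \<Longrightarrow> L \<in> fill G \<Longrightarrow> card L = k"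
  using fill pentagonal_geometry.line_card by metis

lemma fill_nonempty: "G \<in> groups \<Longrightarrow> L \<in> fill G \<Longrightarrow> L \<noteq> {}"
  using fill_card k_ge_2 by fastforce

text \<open>A filling line has at least two points in one group, which no block does. Hence filling
  lines and blocks through a point are counted separately.\<close>

lemma fill_not_block:
  assumes "G \<in> groups" "L \<in> fill G" shows "L \<notin> blocks"
proof
  assume B: "L \<in> blocks"
  from fill_card[OF assms] k_ge_2 have "\<not> is_singleton L" "L \<noteq> {}"
    by (auto simp: is_singleton_altdef)
  then obtain x y where xy: "x \<in> L" "y \<in> L" "x \<noteq> y"
    by (metis all_not_in_conv is_singletonI')
  then show False
    using same_group[OF assms(1) _ _ xy(3) B] fill_subset[OF assms] by auto
qed

text \<open>Two points of one block lie in different groups, where the uniqueness in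
  \<open>distinct_groups\<close> applies.\<close>

lemma block_unique:
  assumes "x \<noteq> y" "B \<in> blocks" "C \<in> blocks" "x \<in> B" "y \<in> B" "x \<in> C" "y \<in> C"
  shows "B = C"
proof -
  obtain G H where GH: "G \<in> groups" "x \<in> G" "H \<in> groups" "y \<in> H"
    using assms block_subset obtain_group by (metis subsetD)
  then have "G \<noteq> H" using same_group assms by blast
  from distinct_groups[OF GH(1,3) this GH(2,4)] assms show ?thesis by blast
qed

section \<open>Collinearity and opposite lines after filling\<close>

text \<open>No block joins two points of \<open>G\<close>, and the filling lines of any other group
  stay in that group, which is disjoint from \<open>G\<close>.\<close>

lemma collinear_same_group:
  assumes "G \<in> groups" "x \<in> G" "y \<in> G"
  shows "collinear filled_lines x y \<longleftrightarrow> collinear (fill G) x y"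
proof -
  have "L \<in> fill G" if "x \<noteq> y" "L \<in> filled_lines" "x \<in> L" "y \<in> L" for L
    using that assms same_group[OF assms] fill_subset group_unique
    unfolding filled_lines_def by blast
  then show ?thesis using assms by (auto simp: collinear_def filled_lines_def)
qed

lemma collinear_distinct_groups:
  assumes "G \<in> groups" "x \<in> G" "H \<in> groups" "y \<in> H" "G \<noteq> H"
  shows "collinear filled_lines x y"
  using distinct_groups[OF assms(1,3,5,2,4)] group_unique assms
  by (auto simp: collinear_def filled_lines_def)

text \<open>Every point outside \<open>G\<close> is joined to \<open>x\<close> by a block, and
  inside \<open>G\<close> collinearity is unchanged.\<close>

lemma opp_filled:
  assumes "G \<in> groups" "x \<in> G"
  shows "opp V filled_lines x = opp G (fill G) x"
proof -
  have "y \<in> G" if "y \<in> V" "\<not> collinear filled_lines x y" for y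
    using that collinear_distinct_groups assms obtain_group by metis
  then show ?thesis
    using collinear_same_group[OF assms] group_subset[OF assms(1)] by (auto simp: opp_def)
qed

section \<open>Degrees and the total number of points\<close>

text \<open>The blocks through \<open>x\<close>, with \<open>x\<close> deleted, partition
  \<open>V - G\<close>. The product form avoids division in the natural numbers.\<close>

lemma card_blocks_through:
  assumes "G \<in> groups" "x \<in> G"
  shows "card {B \<in> blocks. x \<in> B} * (k - 1) = card V - card G"
proof -
  have "(\<Union>B\<in>{B \<in> blocks. x \<in> B}. B - {x}) = V - G"
  proof
    show "(\<Union>B\<in>{B \<in> blocks. x \<in> B}. B - {x}) \<subseteq> V - G"
      using block_subset same_group assms by blast
    show "V - G \<subseteq> (\<Union>B\<in>{B \<in> blocks. x \<in> B}. B - {x})"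
    proof
      fix y assume y: "y \<in> V - G"
      then obtain H where "H \<in> groups" "y \<in> H" using obtain_group by blast
      with y distinct_groups[OF assms(1) this(1) _ assms(2) this(2)] assms(2)
      show "y \<in> (\<Union>B\<in>{B \<in> blocks. x \<in> B}. B - {x})" by blast
    qed
  qed
  moreover have "card (\<Union>B\<in>{B \<in> blocks. x \<in> B}. B - {x}) = card {B \<in> blocks. x \<in> B} * (k - 1)"
  proof (rule card_pencil)
    show "L \<inter> M \<subseteq> {x}" if "L \<in> {B \<in> blocks. x \<in> B}" "M \<in> {B \<in> blocks. x \<in> B}" "L \<noteq> M" for L M
      using that block_unique by blast
  qed (use finite_blocks finite_block block_card in auto)
  ultimately show ?thesis
    using card_Diff_subset[OF finite_group group_subset] assms by simp
qed

lemma degree_filled: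
  assumes "G \<in> groups" "x \<in> G"
  shows "card {L \<in> filled_lines. x \<in> L} = r G + card {B \<in> blocks. x \<in> B}"
proof -
  interpret G: pentagonal_geometry G "fill G" k "r G" using fill assms by blast
  have "{L \<in> filled_lines. x \<in> L} = {L \<in> fill G. x \<in> L} \<union> {B \<in> blocks. x \<in> B}"
    using assms fill_subset group_unique unfolding filled_lines_def by blast
  moreover have "{L \<in> fill G. x \<in> L} \<inter> {B \<in> blocks. x \<in> B} = {}"
    using assms fill_not_block by blast
  ultimately show ?thesis
    using G.finite_lines finite_blocks G.point_degree[OF assms(2)] by (simp add: card_Un_disjoint)
qed

lemma card_filled: "card V = (k - 1) * (\<Sum>G\<in>groups. r G) + card groups * (k + 1)"
proof -
  have "card V = (\<Sum>G\<in>groups. card G)"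
    using product_partition[OF groups_partition] finite_group by simp
  also have "\<dots> = (\<Sum>G\<in>groups. (k - 1) * r G + (k + 1))"
    using pentagonal_geometry.card_points[OF fill] by (intro sum.cong) auto
  finally show ?thesis by (simp only: sum.distrib sum_distrib_left sum_constant of_nat_id distrib_left)
qed

text \<open>The right-hand side does not mention \<open>x\<close>, so all points have the same
  degree. It is stated over the reals because the quotient \<open>(k + 1) / (k - 1)\<close> need not
  be an integer; the left-hand side shows that the whole expression is a natural number.\<close>

lemma degree_filled_eq:
  assumes "x \<in> V"
  shows "real (card {L \<in> filled_lines. x \<in> L})
    = real (\<Sum>G\<in>groups. r G) + (real (card groups) - 1) * (real k + 1) / (real k - 1)"
proof -
  obtain G where G: "G \<in> groups" "x \<in> G" using obtain_group assms by blast
  let ?b = "card {B \<in> blocks. x \<in> B}" and ?R = "\<Sum>G\<in>groups. r G"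
  have "?b * (k - 1) + card G = card V"
    using card_blocks_through[OF G] card_mono[OF finite_V group_subset[OF G(1)]] by simp
  \<comment> \<open>Two counts of \<open>V\<close>: from the point \<open>x\<close>, and as the sum
    of the group sizes. Cancelling one \<open>k + 1\<close> turns \<open>card groups\<close> into
    \<open>card groups - 1\<close>.\<close>
  then have "?b * (k - 1) + ((k - 1) * r G + k + 1) = (k - 1) * ?R + card groups * (k + 1)"
    using card_filled pentagonal_geometry.card_points[OF fill[OF G(1)]] by simp
  then have "real (?b * (k - 1) + ((k - 1) * r G + k + 1))
      = real ((k - 1) * ?R + card groups * (k + 1))" by (rule arg_cong)
  then have "(real k - 1) * (real ?b + real (r G))
      = (real k - 1) * real ?R + (real (card groups) - 1) * (real k + 1)"
    \<comment> \<open>The truncated difference \<open>k - 1\<close> becomes a real difference, since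
      \<open>1 \<le> k\<close>.\<close>
    using k_ge_2 by (simp only: of_nat_add of_nat_mult of_nat_diff[of 1 k]) (simp add: algebra_simps)
  then have "real ?b + real (r G)
      = real ?R + (real (card groups) - 1) * (real k + 1) / (real k - 1)"
    using k_ge_2 by (simp add: field_simps del: of_nat_sum)
  then show ?thesis using degree_filled[OF G] by simp
qed

section \<open>The filled design is a pentagonal geometry\<close>

lemma V_nonempty: "V \<noteq> {}"
  using blocks_nonempty block_subset block_card k_ge_2
  by (metis all_not_in_conv card.empty not_numeral_le_zero subset_empty)

lemma pentagonal_geometry_filled:
  assumes r': "real r' = real (\<Sum>G\<in>groups. r G)
    + (real (card groups) - 1) * (real k + 1) / (real k - 1)"
  shows "pentagonal_geometry V filled_lines k r'"
proof
  show "finite V" "V \<noteq> {}" "2 \<le> k" using finite_V V_nonempty k_ge_2 by auto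
  have card: "card L = k" if "L \<in> filled_lines" for L
    using that fill_card block_card by (auto simp: filled_lines_def)
  then show "card L = k" "2 \<le> card L" if "L \<in> filled_lines" for L using that k_ge_2 by auto
  show "L \<subseteq> V" if "L \<in> filled_lines" for L
    using that fill_subset group_subset block_subset unfolding filled_lines_def by blast
  show "L = M" if hyps: "x \<noteq> y" "L \<in> filled_lines" "M \<in> filled_lines"
    "x \<in> L" "y \<in> L" "x \<in> M" "y \<in> M" for x y L M
  \<comment> \<open>Two points of one group can only be joined by a filling line of that group, two
    points of different groups only by a block; each kind has its own uniqueness.\<close>
  proof (cases "\<exists>G\<in>groups. x \<in> G \<and> y \<in> G")
    case True
    then obtain G where G: "G \<in> groups" "x \<in> G" "y \<in> G" by blast
    interpret G: pentagonal_geometry G "fill G" k "r G" using fill G by blast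
    have "A \<in> fill G" if "A \<in> filled_lines" "x \<in> A" "y \<in> A" for A
      using that G hyps(1) same_group fill_subset group_unique
      unfolding filled_lines_def by blast
    then show ?thesis using hyps G.line_unique by blast
  next
    case False
    then have "A \<in> blocks" if "A \<in> filled_lines" "x \<in> A" "y \<in> A" for A
      using that fill_subset unfolding filled_lines_def by blast
    then show ?thesis using hyps block_unique by blast
  qed
  show degree: "card {L \<in> filled_lines. x \<in> L} = r'" if "x \<in> V" for x
    using degree_filled_eq[OF that] r' by linarith
  \<comment> \<open>Positivity is inherited from the filling: \<open>r'\<close> is the degree of a
    point, and so at least \<open>r G\<close> for its group \<open>G\<close>.\<close>
  show "1 \<le> r'"
  proof -
    obtain x where x: "x \<in> V" using V_nonempty by blast
    then obtain G where G: "G \<in> groups" "x \<in> G" using obtain_group by blast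
    then show ?thesis
      using degree[OF x] degree_filled pentagonal_geometry.r_ge_1[OF fill[OF G(1)]] by simp
  qed
  show "opp V filled_lines x \<in> filled_lines" if "x \<in> V" for x
  proof -
    from that obtain G where G: "G \<in> groups" "x \<in> G" using obtain_group by blast
    then show ?thesis
      using opp_filled pentagonal_geometry.opp_line[OF fill[OF G(1)] G(2)]
      by (auto simp: filled_lines_def)
  qed
qed

section \<open>Opposite line pairs after filling\<close>

lemma opposite_line_pairs_filled:
  "opposite_line_pairs V filled_lines = (\<Union>G\<in>groups. opposite_line_pairs G (fill G))"
proof
  show "opposite_line_pairs V filled_lines \<subseteq> (\<Union>G\<in>groups. opposite_line_pairs G (fill G))"
  proof
    fix X assume "X \<in> opposite_line_pairs V filled_lines"
    then obtain L M where *: "X = {L, M}" "L \<in> filled_lines" "M \<in> filled_lines" "L \<inter> M = {}"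
      "\<forall>x\<in>L. opp V filled_lines x = M" "\<forall>x\<in>M. opp V filled_lines x = L"
      by (rule opposite_line_pairsE)
    have "L \<noteq> {}" "L \<subseteq> V"
      using *(2) fill_nonempty fill_subset group_subset block_subset block_card k_ge_2
      unfolding filled_lines_def by fastforce+
    then obtain x where x: "x \<in> L" "x \<in> V" by blast
    then obtain G where G: "G \<in> groups" "x \<in> G" using obtain_group by blast
    interpret G: pentagonal_geometry G "fill G" k "r G" using fill G by blast
    \<comment> \<open>A priori \<open>L\<close> and \<open>M\<close> could be blocks. But
      \<open>M\<close> is the opposite line of \<open>x \<in> G\<close>, hence a filling line of
      \<open>G\<close>; then \<open>L\<close>, being opposite to a point of \<open>M\<close>, is one
      as well.\<close>
    have M: "M \<in> fill G" using * x opp_filled[OF G] G.opp_line[OF G(2)] by metis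
    then obtain y where y: "y \<in> M" "y \<in> G"
      using G.line_nonempty[OF M] G.lines_subset[OF M] by blast
    have L: "L \<in> fill G" using * y opp_filled[OF G(1) y(2)] G.opp_line[OF y(2)] by metis
    have "opp G (fill G) z = opp V filled_lines z" if "z \<in> L \<union> M" for z
      using that L M G.lines_subset opp_filled[OF G(1)] by blast
    with *(5,6) have "{L, M} \<in> opposite_line_pairs G (fill G)"
      by (intro opposite_line_pairsI[OF L M *(4)]) auto
    then show "X \<in> (\<Union>G\<in>groups. opposite_line_pairs G (fill G))" using G *(1) by blast
  qed
  show "(\<Union>G\<in>groups. opposite_line_pairs G (fill G)) \<subseteq> opposite_line_pairs V filled_lines"
  proof
    fix X assume "X \<in> (\<Union>G\<in>groups. opposite_line_pairs G (fill G))"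
    then obtain G where G: "G \<in> groups" "X \<in> opposite_line_pairs G (fill G)" by blast
    from G(2) obtain L M where *: "X = {L, M}" "L \<in> fill G" "M \<in> fill G" "L \<inter> M = {}"
      "\<forall>x\<in>L. opp G (fill G) x = M" "\<forall>x\<in>M. opp G (fill G) x = L"
      by (rule opposite_line_pairsE)
    with G(1) have "opp G (fill G) z = opp V filled_lines z" if "z \<in> L \<union> M" for z
      using that fill_subset opp_filled by blast
    moreover have "L \<in> filled_lines" "M \<in> filled_lines" using G(1) * by (auto simp: filled_lines_def)
    ultimately show "X \<in> opposite_line_pairs V filled_lines"
      unfolding *(1) using *(4-6) by (intro opposite_line_pairsI) auto
  qed
qed

text \<open>Different groups contribute disjoint families: filling lines are nonempty subsets of
  disjoint groups, so no line is shared, and a pair is a nonempty set of lines.\<close>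

lemma card_opposite_line_pairs_filled:
  "card (opposite_line_pairs V filled_lines)
    = (\<Sum>G\<in>groups. card (opposite_line_pairs G (fill G)))"
  unfolding opposite_line_pairs_filled
proof (rule card_UN_disjoint[OF finite_groups])
  show "\<forall>G\<in>groups. finite (opposite_line_pairs G (fill G))"
  proof
    fix G assume "G \<in> groups"
    then interpret G: pentagonal_geometry G "fill G" k "r G" using fill by blast
    show "finite (opposite_line_pairs G (fill G))"
      using G.finite_lines opposite_line_pairs_subset finite_subset by blast
  qed
  have "fill G \<inter> fill H = {}" if "G \<in> groups" "H \<in> groups" "G \<noteq> H" for G H
  proof (rule ccontr)
    assume "fill G \<inter> fill H \<noteq> {}"
    then obtain L where L: "L \<in> fill G" "L \<in> fill H" by blast
    then obtain x where "x \<in> L" using fill_nonempty \<open>G \<in> groups\<close> by blast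
    then show False using that L fill_subset group_unique by blast
  qed
  moreover have "X \<noteq> {}" if "X \<in> opposite_line_pairs G (fill G)" for X G
    using that by (auto elim: opposite_line_pairsE)
  moreover have "X \<subseteq> fill G" if "X \<in> opposite_line_pairs G (fill G)" for X G
    using that opposite_line_pairs_subset by blast
  ultimately have "X \<notin> opposite_line_pairs H (fill H)"
    if "X \<in> opposite_line_pairs G (fill G)" "G \<in> groups" "H \<in> groups" "G \<noteq> H" for X G H
    using that by (metis Int_greatest subset_empty)
  then show "\<forall>G\<in>groups. \<forall>H\<in>groups. G \<noteq> H
      \<longrightarrow> opposite_line_pairs G (fill G) \<inter> opposite_line_pairs H (fill H) = {}"
    by (auto simp: disjoint_iff)
qed

end

section \<open>Choosing a geometry for each group\<close>

theorem theorem1p1: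
  fixes k n N R P :: nat and r v p u :: "nat \<Rightarrow> nat"
  assumes "k \<ge> 2"
    and "\<And>i. i \<in> {1..n} \<Longrightarrow> r i > 0"
    and "\<And>i. i \<in> {1..n} \<Longrightarrow> v i = (k - 1) * r i + k + 1"
    and "\<And>i. i \<in> {1..n} \<Longrightarrow> exists_PENT k (r i) (p i)"
    and "\<And>i. i \<in> {1..n} \<Longrightarrow> u i > 0"
    and "exists_GDD k (\<Sum>i=1..n. replicate_mset (u i) (v i))"
    and "N = (\<Sum>i=1..n. u i)"
    and "R = (\<Sum>i=1..n. u i * r i)"
    and "P = (\<Sum>i=1..n. u i * p i)"
  shows "\<exists>r'. real r' = real R + (real N - 1) * (real k + 1) / (real k - 1) \<and> exists_PENT k r' P"
proof -
  let ?T = "\<Sum>i=1..n. replicate_mset (u i) (v i)"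
  \<comment> \<open>The type of the design with the index \<open>i\<close> in place of the size
    \<open>v i\<close>; its image under \<open>v\<close> is \<open>?T\<close>.\<close>
  let ?M = "\<Sum>i=1..n. replicate_mset (u i) i"
  from assms(6) obtain V groups blocks
    where gdd: "group_divisible_design k (V :: nat set) groups blocks ?T"
    unfolding exists_GDD_def by blast
  interpret group_divisible_design k V groups blocks ?T by fact
  have fin: "finite groups" using finite_elements[OF finite_V groups_partition] .
  have sum_M: "image_mset h ?M = (\<Sum>i=1..n. replicate_mset (u i) (h i))" for h :: "nat \<Rightarrow> nat"
    by (induction n) auto
  have "image_mset card (mset_set groups) = image_mset v ?M"
    using group_sizes sum_M by simp
  \<comment> \<open>Groups of equal size may have to carry geometries with different numbers of opposite
    line pairs, so each group is assigned an index and not just a size.\<close>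
  from image_mset_lift[OF fin this] obtain f
    where f: "image_mset f (mset_set groups) = ?M" "\<forall>G\<in>groups. card G = v (f G)" by blast
  \<comment> \<open>Exactly \<open>u i\<close> groups receive the index \<open>i\<close>. The
    instances \<open>h = 1\<close>, \<open>h = r\<close> and \<open>h = p\<close> give
    \<open>N\<close>, \<open>R\<close> and \<open>P\<close>.\<close>
  have sum_f: "(\<Sum>G\<in>groups. h (f G)) = (\<Sum>i=1..n. u i * h i)" for h :: "nat \<Rightarrow> nat"
  proof -
    have "(\<Sum>G\<in>groups. h (f G)) = sum_mset (image_mset h (image_mset f (mset_set groups)))"
      by (simp add: sum_unfold_sum_mset image_mset.compositionality comp_def)
    also have "\<dots> = sum_mset (\<Sum>i=1..n. replicate_mset (u i) (h i))" by (simp only: f sum_M)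
    also have "\<dots> = (\<Sum>i=1..n. u i * h i)" by (induction n) auto
    finally show ?thesis .
  qed
  have "f G \<in> {1..n}" if "G \<in> groups" for G
  proof -
    have "f G \<in># ?M" unfolding f(1)[symmetric] using that fin by simp
    moreover have "set_mset ?M \<subseteq> {1..n}" by (induction n) auto
    ultimately show ?thesis by blast
  qed
  moreover have "finite G" if "G \<in> groups" for G
    using that partition_onD1[OF groups_partition] finite_V by (auto intro: finite_subset[of G V])
  \<comment> \<open>The size \<open>v (f G)\<close> of \<open>G\<close> is the number of points of
    the geometry with index \<open>f G\<close>, which can thus be placed on
    \<open>G\<close>.\<close>
  ultimately have "\<exists>lines. pentagonal_geometry G lines k (r (f G))
      \<and> card (opposite_line_pairs G lines) = p (f G)" if "G \<in> groups" for G
    using that f(2) assms(3,4) by (intro exists_PENT_on) auto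
  then obtain fill where pent: "\<And>G. G \<in> groups \<Longrightarrow> pentagonal_geometry G (fill G) k (r (f G))"
    "\<And>G. G \<in> groups \<Longrightarrow> card (opposite_line_pairs G (fill G)) = p (f G)" by metis
  interpret filled_gdd k V groups blocks ?T fill "r \<circ> f"
    using pent(1) assms(1) gdd by (intro filled_gdd.intro filled_gdd_axioms.intro) auto
  have NR: "card groups = N" "(\<Sum>G\<in>groups. (r \<circ> f) G) = R"
    using sum_f[of "\<lambda>_. 1"] sum_f[of r] assms(7,8) by auto
  obtain x where "x \<in> V" using V_nonempty by blast
  \<comment> \<open>The degree of an arbitrary point is a natural number that satisfies the required
    real equation, so no divisibility argument is needed.\<close>
  define r' where "r' = card {L \<in> filled_lines. x \<in> L}"
  have r': "real r' = real R + (real N - 1) * (real k + 1) / (real k - 1)"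
    using degree_filled_eq[OF \<open>x \<in> V\<close>] unfolding r'_def NR .
  then have "pentagonal_geometry V filled_lines k r'"
    using pentagonal_geometry_filled unfolding NR by blast
  moreover have "card (opposite_line_pairs V filled_lines) = P"
    using card_opposite_line_pairs_filled pent(2) sum_f[of p] assms(9) by simp
  ultimately show ?thesis using r' unfolding exists_PENT_def by blast
qed

end
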